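(* Let $0=T_0<T_1<\dots<T_K=T$ be knots, let $\mathbf{a}:[0,T]\to\mathbb{R}^{N_\Lambda}$ be piecewise constant with $\mathbf{a}(t)=\mathbf{a}^{(k)}$ for $t\in[T_k,T_{k+1})$, $k=0,\dots,K-1$, and let $\mathbf{z}:[0,T]\to\mathbb{R}^n$ be continuous and satisfy $$\dot{\mathbf{z}}(t)=\mathbf{J}\,\nabla_z H(\mathbf{z}(t);\mathbf{a}(t)),\qquad \mathbf{z}(0)=\mathbf{z}_0,$$ on each open subinterval $(T_k,T_{k+1})$, where $H(\mathbf{z};\mathbf{a})=\boldsymbol{\Lambda}(\mathbf{z})^\top\mathbf{a}$ is the parametrized polynomial Hamiltonian defined in the context. For each interior knot $T_k$, $k=1,\dots,K-1$, let $\mathbf{C}_k\in\mathbb{R}^{3n\times N_\Lambda}$ be the continuity-constraint matrix defined in the context. If $$\mathbf{C}_k\big(\mathbf{a}^{(k)}-\mathbf{a}^{(k-1)}\big)=0\qquad\text{for every } k=1,\dots,K-1,$$ then $\mathbf{z}\in\mathcal{C}^3([0,T])$.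
   Context: Let $n=2d$ be the (even) state dimension, let $\mathbf{J}=\begin{bmatrix}0&\mathbf{I}\\-\mathbf{I}&0\end{bmatrix}\in\mathbb{R}^{n\times n}$ with $d\times d$ blocks, and let $p=2l$ for an integer $l\ge 1$. Monomial basis: with multi-indices $\boldsymbol{\alpha}\in\mathbb{N}^n$ ($\mathbb{N}$ including $0$), $|\boldsymbol{\alpha}|=\sum_i\alpha_i$, $\mathbf{z}^{\boldsymbol{\alpha}}=\prod_i z_i^{\alpha_i}$, and canonical basis vectors $\mathbf{e}_i$ of $\mathbb{R}^n$, put $$\mathcal{A}_{p-1}=\{\boldsymbol{\alpha}\in\mathbb{N}^n: 0<|\boldsymbol{\alpha}|\le p-1\},\quad \mathcal{E}_p=\{p\,\mathbf{e}_1,\dots,p\,\mathbf{e}_n\},\quad \mathcal{R}_p=\mathcal{A}_{p-1}\cup\mathcal{E}_p.$$ The basis is $\boldsymbol{\Lambda}(\mathbf{z})=[\mathbf{z}^{\boldsymbol{\alpha}}]_{\boldsymbol{\alpha}\in\mathcal{R}_p}:\mathbb{R}^n\to\mathbb{R}^{N_\Lambda}$ with $N_\Lambda=\binom{n+p-1}{p-1}+n-1$, and for $\mathbf{a}\in\mathbb{R}^{N_\Lambda}$ the Hamiltonian is $H(\mathbf{z};\mathbf{a})=\boldsymbol{\Lambda}(\mathbf{z})^\top\mathbf{a}$. Derivatives of the basis: $\nabla_z\boldsymbol{\Lambda}(\mathbf{z})$ is the $n\times N_\Lambda$ matrix whose $i$-th column is the gradient of the $i$-th component $\Lambda_i$;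 $\nabla_z^2\boldsymbol{\Lambda}(\mathbf{z})(\mathbf{v},\cdot)$ is the $n\times N_\Lambda$ matrix whose $i$-th column is the Hessian of $\Lambda_i$ at $\mathbf{z}$ applied to $\mathbf{v}$; $\nabla_z^3\boldsymbol{\Lambda}(\mathbf{z})(\mathbf{u},\mathbf{v},\cdot)$ is the $n\times N_\Lambda$ matrix whose $i$-th column is the third-derivative tensor of $\Lambda_i$ at $\mathbf{z}$ contracted with $\mathbf{u}$ and $\mathbf{v}$. Continuity-constraint matrix: at a knot $T_k$ write $\mathbf{z}_k=\mathbf{z}(T_k)$, let $\dot{\mathbf{z}}_k^-=\lim_{h\to0^+}\frac{\mathbf{z}(T_k)-\mathbf{z}(T_k-h)}{h}$ be the left first derivative, and let $\ddot{\mathbf{z}}_k^-=\lim_{h\to0^+}\frac{\dot{\mathbf{z}}_k^--\dot{\mathbf{z}}(T_k-h)}{h}$ be the left second derivative. Define $$\boldsymbol{\Lambda}_k^1=\nabla_z\boldsymbol{\Lambda}(\mathbf{z}_k),\qquad \boldsymbol{\Lambda}_k^2=\nabla_z^2\boldsymbol{\Lambda}(\mathbf{z}_k)(\dot{\mathbf{z}}_k^-,\cdot),$$ $$\boldsymbol{\Lambda}_k^3=\nabla_z^3\boldsymbol{\Lambda}(\mathbf{z}_k)(\dot{\mathbf{z}}_k^-,\dot{\mathbf{z}}_k^-,\cdot)+\nabla_z^2\boldsymbol{\Lambda}(\mathbf{z}_k)(\ddot{\mathbf{z}}_k^-,\cdot),$$ and $\mathbf{C}_k=\begin{bmatrix}\boldsymbol{\Lambda}_k^1\\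 \boldsymbol{\Lambda}_k^2\\ \boldsymbol{\Lambda}_k^3\end{bmatrix}\in\mathbb{R}^{3n\times N_\Lambda}$. $\mathcal{C}^3([0,T])$ denotes functions three times continuously differentiable on $[0,T]$ (one-sided derivatives at the endpoints). *)

theory Defs
  imports "HOL-Analysis.Analysis"
begin

text \<open>
  The state space \<open>\<real>\<^sup>n\<close>, \<open>n = 2d\<close>, is \<^typ>\<open>real ^ ('d + 'd)\<close>, so that \<^const>\<open>Inl\<close> and \<^const>\<open>Inr\<close>
  address the two halves of the coordinates.
\<close>

definition J :: "real ^ ('d::finite + 'd) ^ ('d + 'd)" where
  "J = (\<chi> r c. case (r, c) of
          (Inl i, Inr j) \<Rightarrow> (mat 1 :: real ^ 'd ^ 'd) $ i $ j
        | (Inr i, Inl j) \<Rightarrow> - (mat 1 :: real ^ 'd ^ 'd) $ i $ j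
        | _ \<Rightarrow> 0)"

definition midx_deg :: "nat ^ 'n::finite \<Rightarrow> nat" where
  "midx_deg \<alpha> = (\<Sum>i\<in>UNIV. \<alpha> $ i)"

definition monomial :: "nat ^ 'n::finite \<Rightarrow> real ^ 'n \<Rightarrow> real" where
  "monomial \<alpha> z = (\<Prod>i\<in>UNIV. (z $ i) ^ (\<alpha> $ i))"

definition A_set :: "nat \<Rightarrow> (nat ^ 'n::finite) set" where
  "A_set q = {\<alpha>. 0 < midx_deg \<alpha> \<and> midx_deg \<alpha> \<le> q}"

definition E_set :: "nat \<Rightarrow> (nat ^ 'n::finite) set" where
  "E_set p = range (\<lambda>i. axis i p)"

definition R_set :: "nat \<Rightarrow> (nat ^ 'n::finite) set" where
  "R_set p = A_set (p - 1) \<union> E_set p"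

text \<open>
  Coefficient vectors are elements of \<^typ>\<open>real ^ 'm\<close>, where the monomials are listed by an
  enumeration \<open>\<nu> :: 'm \<Rightarrow> nat ^ 'n\<close>, to be assumed a bijection onto \<^term>\<open>R_set p\<close>;
  then \<open>CARD('m) = card (R_set p)\<close> is the number \<open>N\<^sub>\<Lambda>\<close> of basis functions.
\<close>

definition basis :: "('m::finite \<Rightarrow> nat ^ 'n::finite) \<Rightarrow> real ^ 'n \<Rightarrow> real ^ 'm" where
  "basis \<nu> z = (\<chi> i. monomial (\<nu> i) z)"

definition hamiltonian ::
    "('m::finite \<Rightarrow> nat ^ 'n::finite) \<Rightarrow> real ^ 'n \<Rightarrow> real ^ 'm \<Rightarrow> real" where
  "hamiltonian \<nu> z a = basis \<nu> z \<bullet> a"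

definition pderiv_at :: "'n \<Rightarrow> (real ^ 'n::finite \<Rightarrow> real) \<Rightarrow> real ^ 'n \<Rightarrow> real" where
  "pderiv_at i f z = frechet_derivative f (at z) (axis i 1)"

definition grad :: "(real ^ 'n::finite \<Rightarrow> real) \<Rightarrow> real ^ 'n \<Rightarrow> real ^ 'n" where
  "grad f z = (\<chi> i. pderiv_at i f z)"

definition hessian :: "(real ^ 'n::finite \<Rightarrow> real) \<Rightarrow> real ^ 'n \<Rightarrow> real ^ 'n ^ 'n" where
  "hessian f z = (\<chi> i j. pderiv_at i (pderiv_at j f) z)"

definition third_tensor :: "(real ^ 'n::finite \<Rightarrow> real) \<Rightarrow> real ^ 'n \<Rightarrow> real ^ 'n ^ 'n ^ 'n" where
  "third_tensor f z = (\<chi> i j k. pderiv_at i (pderiv_at j (pderiv_at k f)) z)"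

definition contract2 :: "real ^ 'n ^ 'n ^ 'n \<Rightarrow> real ^ 'n::finite \<Rightarrow> real ^ 'n \<Rightarrow> real ^ 'n" where
  "contract2 D u v = (\<chi> i. \<Sum>j\<in>UNIV. \<Sum>k\<in>UNIV. D $ i $ j $ k * u $ j * v $ k)"

definition basis_D1 ::
    "('m::finite \<Rightarrow> nat ^ 'n::finite) \<Rightarrow> real ^ 'n \<Rightarrow> real ^ 'm ^ 'n" where
  "basis_D1 \<nu> z = (\<chi> r i. grad (\<lambda>y. basis \<nu> y $ i) z $ r)"

definition basis_D2 ::
    "('m::finite \<Rightarrow> nat ^ 'n::finite) \<Rightarrow> real ^ 'n \<Rightarrow> real ^ 'n \<Rightarrow> real ^ 'm ^ 'n" where
  "basis_D2 \<nu> z v = (\<chi> r i. (hessian (\<lambda>y. basis \<nu> y $ i) z *v v) $ r)"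

definition basis_D3 ::
    "('m::finite \<Rightarrow> nat ^ 'n::finite) \<Rightarrow> real ^ 'n \<Rightarrow> real ^ 'n \<Rightarrow> real ^ 'n \<Rightarrow> real ^ 'm ^ 'n" where
  "basis_D3 \<nu> z u v = (\<chi> r i. contract2 (third_tensor (\<lambda>y. basis \<nu> y $ i) z) u v $ r)"

definition left_deriv1 :: "(real \<Rightarrow> 'a::real_normed_vector) \<Rightarrow> real \<Rightarrow> 'a" where
  "left_deriv1 z t = Lim (at_right 0) (\<lambda>h. (z t - z (t - h)) /\<^sub>R h)"

definition left_deriv2 :: "(real \<Rightarrow> 'a::real_normed_vector) \<Rightarrow> real \<Rightarrow> 'a" where
  "left_deriv2 z t =
     Lim (at_right 0) (\<lambda>h. (left_deriv1 z t - vector_derivative z (at (t - h))) /\<^sub>R h)"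

text \<open>The matrix \<open>C\<^sub>k\<close>, as a function of the trajectory \<open>z\<close> and the knot \<open>t = T\<^sub>k\<close>;
  its \<open>3n\<close> rows are indexed by \<^typ>\<open>'n + 'n + 'n\<close>.\<close>

definition continuity_matrix ::
    "('m::finite \<Rightarrow> nat ^ 'n::finite) \<Rightarrow> (real \<Rightarrow> real ^ 'n) \<Rightarrow> real \<Rightarrow> real ^ 'm ^ ('n + 'n + 'n)" where
  "continuity_matrix \<nu> z t =
     (let z1 = left_deriv1 z t;
          z2 = left_deriv2 z t;
          L1 = basis_D1 \<nu> (z t);
          L2 = basis_D2 \<nu> (z t) z1;
          L3 = basis_D3 \<nu> (z t) z1 z1 + basis_D2 \<nu> (z t) z2
      in \<chi> r. case r of Inl i \<Rightarrow> L1 $ i | Inr (Inl i) \<Rightarrow> L2 $ i | Inr (Inr i) \<Rightarrow> L3 $ i)"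

text \<open>\<open>f \<in> C\<^sup>k(S)\<close>, with \<open>F j\<close> the \<open>j\<close>-th derivative of \<open>f\<close>; for \<open>S\<close> a compact interval,
  \<open>at t within S\<close> makes the derivatives at the endpoints one-sided.\<close>

definition C_k_on :: "nat \<Rightarrow> (real \<Rightarrow> 'a::real_normed_vector) \<Rightarrow> real set \<Rightarrow> bool" where
  "C_k_on k f S \<longleftrightarrow>
     (\<exists>F. (\<forall>t\<in>S. F 0 t = f t) \<and>
          (\<forall>j<k. \<forall>t\<in>S. (F j has_vector_derivative F (Suc j) t) (at t within S)) \<and>
          (\<forall>j\<le>k. continuous_on S (F j)))"

end

theory Submission
  imports Defs
begin

text \<open>
  On a single closed knot interval the coefficient vector is constant, so \<open>z\<close> solves an autonomous
  equation \<open>z' = X(z)\<close> with a polynomial vector field \<open>X\<close>.  Differentiating the equation along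
  the solution expresses the first three derivatives of \<open>z\<close> as continuous functions \<open>velocity\<close>,
  \<open>acceleration\<close> and \<open>jerk\<close> of the state alone (\<open>velocity_along_solution\<close>,
  \<open>acceleration_along_solution\<close>).  These formulas hold up to the endpoints, with one-sided
  derivatives, because a continuous function whose derivative extends continuously to an endpoint
  is differentiable there (\<open>has_vector_derivative_closed_interval\<close>).  Hence \<open>z\<close> is of class
  \<open>C\<^sup>3\<close> on every closed piece, and only the values of the first three derivatives on the two sides
  of an interior knot have to be compared.

  This is what the continuity constraint controls.  The left derivatives \<open>z\<^sub>1\<close>, \<open>z\<^sub>2\<close> in it are the
  velocity and the acceleration for the old coefficients.  The first block of rows implies that old
  and new coefficients give the same velocity.  Since the new velocity is therefore also
  \<open>z\<^sub>1\<close>, the second block, in which \<open>z\<^sub>1\<close> is the direction of differentiation, implies that the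
  accelerations agree; with both velocity and acceleration equal, the third block gives equality of
  the third derivatives (\<open>jets_agree\<close>).  Pieces whose derivatives agree at the knots glue to
  a \<open>C\<^sup>3\<close> function (\<open>C_k_on_glue\<close>).
\<close>

section \<open>Partial derivatives of monomials\<close>

lemma has_vector_derivative_vec_lambda:
  fixes f :: "'i::finite \<Rightarrow> real \<Rightarrow> real"
  assumes "\<And>i. (f i has_vector_derivative f' i) (at t within S)"
  shows "((\<lambda>s. \<chi> i. f i s) has_vector_derivative (\<chi> i. f' i)) (at t within S)"
  using assms unfolding has_vector_derivative_def
  by (subst has_derivative_componentwise_within) (auto simp: Basis_vec_def inner_axis)

text \<open>
  Subtraction of exponents truncates at \<open>0\<close>, so for \<open>\<alpha> $ i = 0\<close> the index \<open>\<alpha> - axis i 1\<close> is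
  just \<open>\<alpha>\<close>; the factor \<open>\<alpha> $ i\<close> makes the formula right in that case as well.
\<close>

lemma monomial_has_derivative:
  "(monomial \<alpha> has_derivative
     (\<lambda>h. \<Sum>i\<in>UNIV. h $ i * (real (\<alpha> $ i) * monomial (\<alpha> - axis i 1) z))) (at z)"
proof -
  have split: "monomial (\<alpha> - axis i 1) z
      = z $ i ^ (\<alpha> $ i - 1) * (\<Prod>j\<in>UNIV - {i}. z $ j ^ (\<alpha> $ j))" for i
    unfolding monomial_def by (subst prod.remove[of _ i]) (auto simp: axis_def intro!: prod.cong)
  show ?thesis
    unfolding split unfolding monomial_def[abs_def]
    by (auto intro!: derivative_eq_intros bounded_linear_imp_has_derivative bounded_linear_vec_nth sum.cong
        simp: fun_eq_iff algebra_simps)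
qed

text \<open>
  Partial differentiation multiplies a monomial by a constant besides lowering an exponent.  Admitting
  a constant factor gives a class of smooth functions closed under partial
  differentiation, so that basis functions and their partial derivatives of any order can be treated
  alike.
\<close>

definition scaled_monomials :: "(real ^ 'n::finite \<Rightarrow> real) set" where
  "scaled_monomials = {\<lambda>y. c * monomial \<alpha> y | c \<alpha>. True}"

lemma monomial_in_scaled_monomials: "monomial \<alpha> \<in> scaled_monomials"
  unfolding scaled_monomials_def by (auto intro!: exI[of _ 1] exI[of _ \<alpha>])

lemma pderiv_at_eqI:
  "(f has_derivative f') (at z) \<Longrightarrow> pderiv_at i f z = f' (axis i 1)"
  unfolding pderiv_at_def using frechet_derivative_at by metis

lemma pderiv_at_scaled_monomial:
  "pderiv_at i (\<lambda>y. c * monomial \<alpha> y) = (\<lambda>y. (c * real (\<alpha> $ i)) * monomial (\<alpha> - axis i 1) y)"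
proof
  fix z
  have "pderiv_at i (\<lambda>y. c * monomial \<alpha> y) z
      = c * (\<Sum>j\<in>UNIV. axis i 1 $ j * (real (\<alpha> $ j) * monomial (\<alpha> - axis j 1) z))"
    by (rule pderiv_at_eqI[OF has_derivative_mult_right[OF monomial_has_derivative]])
  also have "\<dots> = (c * real (\<alpha> $ i)) * monomial (\<alpha> - axis i 1) z"
    by (simp add: axis_def if_distrib[of "\<lambda>x. x * _"] cong: if_cong)
  finally show "pderiv_at i (\<lambda>y. c * monomial \<alpha> y) z
      = (c * real (\<alpha> $ i)) * monomial (\<alpha> - axis i 1) z" .
qed

lemma pderiv_at_in_scaled_monomials:
  "f \<in> scaled_monomials \<Longrightarrow> pderiv_at i f \<in> scaled_monomials"
  unfolding scaled_monomials_def by (force simp: pderiv_at_scaled_monomial)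

lemma scaled_monomials_differentiable: "f \<in> scaled_monomials \<Longrightarrow> f differentiable (at z)"
  unfolding scaled_monomials_def
  by (auto intro: differentiableI[OF has_derivative_mult_right[OF monomial_has_derivative]])

text \<open>
  On monomials the symmetry of second derivatives is a computation: both orders produce the factor
  \<open>\<alpha>\<^sub>i \<alpha>\<^sub>j\<close> for \<open>i \<noteq> j\<close>, and there is nothing to show for \<open>i = j\<close>.
\<close>

lemma pderiv_at_commute:
  assumes "f \<in> scaled_monomials"
  shows "pderiv_at i (pderiv_at j f) = pderiv_at j (pderiv_at i f)"
proof -
  obtain c \<alpha> where f: "f = (\<lambda>y. c * monomial \<alpha> y)"
    using assms unfolding scaled_monomials_def by auto
  have "\<alpha> - axis j 1 - axis i 1 = \<alpha> - axis i 1 - axis j 1"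
    by (simp add: vec_eq_iff add.commute)
  moreover have "\<alpha> $ j * (\<alpha> - axis j 1) $ i = \<alpha> $ i * (\<alpha> - axis i 1) $ j"
    by (cases "i = j") (auto simp: axis_def)
  ultimately show ?thesis
    unfolding f pderiv_at_scaled_monomial by (simp add: mult.assoc flip: of_nat_mult)
qed

lemma has_derivative_pderiv_at:
  assumes "f differentiable (at z)"
  shows "(f has_derivative (\<lambda>h. \<Sum>j\<in>UNIV. pderiv_at j f z * h $ j)) (at z)"
proof -
  have D: "(f has_derivative frechet_derivative f (at z)) (at z)"
    using assms frechet_derivative_works by blast
  interpret linear "frechet_derivative f (at z)"
    using D by (rule has_derivative_linear)
  have "frechet_derivative f (at z) = (\<lambda>h. \<Sum>j\<in>UNIV. pderiv_at j f z * h $ j)"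
  proof
    fix h
    have "frechet_derivative f (at z) h = frechet_derivative f (at z) (\<Sum>j\<in>UNIV. h $ j *\<^sub>R axis j 1)"
      by (simp add: basis_expansion scalar_mult_eq_scaleR[symmetric])
    then show "frechet_derivative f (at z) h = (\<Sum>j\<in>UNIV. pderiv_at j f z * h $ j)"
      by (simp add: sum scale pderiv_at_def mult.commute)
  qed
  with D show ?thesis by simp
qed

lemma has_vector_derivative_along_curve:
  assumes "f differentiable (at (z t))" and "(z has_vector_derivative v) (at t within S)"
  shows "((\<lambda>s. f (z s)) has_vector_derivative (\<Sum>j\<in>UNIV. pderiv_at j f (z t) * v $ j)) (at t within S)"
  using has_derivative_compose[OF assms(2)[unfolded has_vector_derivative_def]
      has_derivative_pderiv_at[OF assms(1)]]
  unfolding has_vector_derivative_def by (simp add: sum_distrib_left mult_ac)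

section \<open>Derivatives of the basis along a curve\<close>

lemma basis_nth: "(\<lambda>y. basis \<nu> y $ i) = monomial (\<nu> i)"
  by (simp add: basis_def fun_eq_iff)

lemma basis_D1_mult:
  "basis_D1 \<nu> z *v b = (\<chi> r. \<Sum>i\<in>UNIV. pderiv_at r (monomial (\<nu> i)) z * b $ i)"
  by (simp add: basis_D1_def grad_def basis_nth matrix_vector_mult_def vec_eq_iff)

text \<open>
  In the Hessian and in the third-derivative tensor the row index belongs to the outermost partial
  derivative.  When the gradient is differentiated along a curve, the row index belongs instead to
  the innermost one.  The next two formulas are written in the latter order, which is the one
  produced by the chain rule; the symmetry of partial derivatives justifies the exchange.
\<close>

lemma basis_D2_mult:
  "basis_D2 \<nu> z v *v b =
     (\<chi> r. \<Sum>i\<in>UNIV. (\<Sum>j\<in>UNIV. pderiv_at j (pderiv_at r (monomial (\<nu> i))) z * v $ j) * b $ i)"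
  by (simp add: basis_D2_def hessian_def basis_nth matrix_vector_mult_def vec_eq_iff
      pderiv_at_commute[OF monomial_in_scaled_monomials])

lemma basis_D3_mult:
  "basis_D3 \<nu> z u v *v b =
     (\<chi> r. \<Sum>i\<in>UNIV. (\<Sum>j\<in>UNIV. \<Sum>k\<in>UNIV.
        pderiv_at j (pderiv_at k (pderiv_at r (monomial (\<nu> i)))) z * u $ j * v $ k) * b $ i)"
proof -
  have "third_tensor (monomial \<alpha>) z $ r $ j $ k
      = pderiv_at j (pderiv_at k (pderiv_at r (monomial \<alpha>))) z" for r j k \<alpha>
    unfolding third_tensor_def vec_lambda_beta
    by (metis pderiv_at_commute pderiv_at_in_scaled_monomials monomial_in_scaled_monomials)
  then show ?thesis
    by (simp add: basis_D3_def contract2_def basis_nth matrix_vector_mult_def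
        vec_eq_iff)
qed

lemma grad_hamiltonian: "grad (\<lambda>y. hamiltonian \<nu> y b) z = basis_D1 \<nu> z *v b"
proof -
  have "((\<lambda>y. hamiltonian \<nu> y b) has_derivative
      (\<lambda>h. \<Sum>i\<in>UNIV. (\<Sum>j\<in>UNIV. pderiv_at j (monomial (\<nu> i)) z * h $ j) * b $ i)) (at z)"
    unfolding hamiltonian_def basis_def inner_vec_def
    by (auto intro!: derivative_eq_intros has_derivative_pderiv_at
        scaled_monomials_differentiable monomial_in_scaled_monomials)
  from pderiv_at_eqI[OF this] show ?thesis
    by (simp add: grad_def basis_D1_mult vec_eq_iff axis_def if_distrib[of "\<lambda>x. _ * x"] cong: if_cong)
qed

lemma basis_D1_along_curve:
  assumes "(z has_vector_derivative v) (at t within S)"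
  shows "((\<lambda>s. basis_D1 \<nu> (z s) *v b) has_vector_derivative basis_D2 \<nu> (z t) v *v b) (at t within S)"
  unfolding basis_D1_mult basis_D2_mult
  by (auto intro!: has_vector_derivative_vec_lambda has_vector_derivative_sum
      has_vector_derivative_mult_left has_vector_derivative_along_curve assms
      scaled_monomials_differentiable pderiv_at_in_scaled_monomials monomial_in_scaled_monomials)

text \<open>
  The direction \<open>w\<close> moves along with the curve.  With \<open>v\<close> and \<open>w\<close> the first and \<open>w'\<close> the
  second derivative of \<open>z\<close>, the matrix in the result is the third block of rows of the
  continuity-constraint matrix.
\<close>

lemma basis_D2_along_curve:
  assumes z: "(z has_vector_derivative v) (at t within S)"
    and w: "(w has_vector_derivative w') (at t within S)"
  shows "((\<lambda>s. basis_D2 \<nu> (z s) (w s) *v b) has_vector_derivative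
           (basis_D3 \<nu> (z t) v (w t) + basis_D2 \<nu> (z t) w') *v b) (at t within S)"
proof -
  have wk: "((\<lambda>s. w s $ k) has_vector_derivative w' $ k) (at t within S)" for k
    by (rule bounded_linear.has_vector_derivative[OF bounded_linear_vec_nth w])
  have Pk: "((\<lambda>s. pderiv_at k (pderiv_at r (monomial (\<nu> i))) (z s)) has_vector_derivative
      (\<Sum>j\<in>UNIV. pderiv_at j (pderiv_at k (pderiv_at r (monomial (\<nu> i)))) (z t) * v $ j))
      (at t within S)" for k r i
    by (intro has_vector_derivative_along_curve z scaled_monomials_differentiable
        pderiv_at_in_scaled_monomials monomial_in_scaled_monomials)
  have Q: "((\<lambda>s. basis_D2 \<nu> (z s) (w s) *v b) has_vector_derivative
     (\<chi> r. \<Sum>i\<in>UNIV. (\<Sum>k\<in>UNIV. pderiv_at k (pderiv_at r (monomial (\<nu> i))) (z t) * w' $ k +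
        (\<Sum>j\<in>UNIV. pderiv_at j (pderiv_at k (pderiv_at r (monomial (\<nu> i)))) (z t) * v $ j) * w t $ k)
        * b $ i)) (at t within S)"
    unfolding basis_D2_mult
    by (intro has_vector_derivative_vec_lambda has_vector_derivative_sum
      has_vector_derivative_mult_left has_vector_derivative_mult wk Pk)
  have sw: "(\<Sum>k\<in>UNIV. (\<Sum>j\<in>UNIV. pderiv_at j (pderiv_at k (pderiv_at r (monomial (\<nu> i)))) (z t) * v $ j) * w t $ k)
    = (\<Sum>j\<in>UNIV. \<Sum>k\<in>UNIV. pderiv_at j (pderiv_at k (pderiv_at r (monomial (\<nu> i)))) (z t) * v $ j * w t $ k)"
    for r i
    by (subst sum.swap) (simp add: sum_distrib_right)
  show ?thesis
    using Q unfolding matrix_vector_mult_add_rdistrib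
    unfolding basis_D3_mult basis_D2_mult[of _ _ w'] sum.distrib sw
    by (simp add: plus_vec_def distrib_right sum.distrib add.commute)
qed

lemma continuous_on_scaled_monomial:
  assumes "f \<in> scaled_monomials" "continuous_on S z"
  shows "continuous_on S (\<lambda>s. f (z s))"
proof (rule continuous_on_compose2[OF _ assms(2)])
  show "continuous_on UNIV f"
    using scaled_monomials_differentiable[OF assms(1)]
    by (auto intro: differentiable_imp_continuous_on simp: differentiable_on_def)
qed simp

lemma continuous_on_basis_D1:
  "continuous_on S z \<Longrightarrow> continuous_on S (\<lambda>s. basis_D1 \<nu> (z s) *v b)"
  unfolding basis_D1_mult
  by (intro continuous_intros continuous_on_scaled_monomial pderiv_at_in_scaled_monomials
      monomial_in_scaled_monomials)

lemma continuous_on_basis_D2: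
  "continuous_on S z \<Longrightarrow> continuous_on S v \<Longrightarrow> continuous_on S (\<lambda>s. basis_D2 \<nu> (z s) (v s) *v b)"
  unfolding basis_D2_mult
  by (intro continuous_intros continuous_on_scaled_monomial pderiv_at_in_scaled_monomials
      monomial_in_scaled_monomials)

lemma continuous_on_basis_D3:
  "continuous_on S z \<Longrightarrow> continuous_on S u \<Longrightarrow> continuous_on S v \<Longrightarrow>
    continuous_on S (\<lambda>s. basis_D3 \<nu> (z s) (u s) (v s) *v b)"
  unfolding basis_D3_mult
  by (intro continuous_intros continuous_on_scaled_monomial pderiv_at_in_scaled_monomials
      monomial_in_scaled_monomials)


section \<open>Higher derivatives of a solution as functions of the state\<close>

text \<open>
  The first three time derivatives of a solution of \<open>z' = A (\<nabla>\<Lambda>(z) b)\<close>, read as functions of the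
  state \<open>y = z(t)\<close>.  In this form they make sense at a knot for the coefficients of either
  neighbouring interval.
\<close>

definition velocity ::
    "real ^ 'n ^ 'n \<Rightarrow> ('m::finite \<Rightarrow> nat ^ 'n::finite) \<Rightarrow> real ^ 'm \<Rightarrow> real ^ 'n \<Rightarrow> real ^ 'n" where
  "velocity A \<nu> b y = A *v (basis_D1 \<nu> y *v b)"

definition acceleration ::
    "real ^ 'n ^ 'n \<Rightarrow> ('m::finite \<Rightarrow> nat ^ 'n::finite) \<Rightarrow> real ^ 'm \<Rightarrow> real ^ 'n \<Rightarrow> real ^ 'n" where
  "acceleration A \<nu> b y = A *v (basis_D2 \<nu> y (velocity A \<nu> b y) *v b)"

definition jerk ::
    "real ^ 'n ^ 'n \<Rightarrow> ('m::finite \<Rightarrow> nat ^ 'n::finite) \<Rightarrow> real ^ 'm \<Rightarrow> real ^ 'n \<Rightarrow> real ^ 'n" where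
  "jerk A \<nu> b y = A *v ((basis_D3 \<nu> y (velocity A \<nu> b y) (velocity A \<nu> b y)
                     + basis_D2 \<nu> y (acceleration A \<nu> b y)) *v b)"

lemma velocity_along_solution:
  assumes "(z has_vector_derivative velocity A \<nu> b (z t)) (at t within S)"
  shows "((\<lambda>s. velocity A \<nu> b (z s)) has_vector_derivative acceleration A \<nu> b (z t)) (at t within S)"
  using bounded_linear.has_vector_derivative[OF matrix_vector_mul_bounded_linear
      basis_D1_along_curve[OF assms]]
  by (simp only: velocity_def acceleration_def)

lemma acceleration_along_solution:
  assumes "(z has_vector_derivative velocity A \<nu> b (z t)) (at t within S)"
  shows "((\<lambda>s. acceleration A \<nu> b (z s)) has_vector_derivative jerk A \<nu> b (z t)) (at t within S)"
  using bounded_linear.has_vector_derivative[OF matrix_vector_mul_bounded_linear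
      basis_D2_along_curve[OF assms velocity_along_solution[OF assms]]]
  by (simp only: acceleration_def jerk_def)

lemma continuous_on_velocity:
  "continuous_on S z \<Longrightarrow> continuous_on S (\<lambda>t. velocity A \<nu> b (z t))"
  unfolding velocity_def
  by (intro bounded_linear.continuous_on[OF matrix_vector_mul_bounded_linear]
      continuous_on_basis_D1)

lemma continuous_on_acceleration:
  "continuous_on S z \<Longrightarrow> continuous_on S (\<lambda>t. acceleration A \<nu> b (z t))"
  unfolding acceleration_def
  by (intro bounded_linear.continuous_on[OF matrix_vector_mul_bounded_linear]
      continuous_on_basis_D2 continuous_on_velocity)

lemma continuous_on_jerk:
  "continuous_on S z \<Longrightarrow> continuous_on S (\<lambda>t. jerk A \<nu> b (z t))"
  unfolding jerk_def matrix_vector_mult_add_rdistrib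
  by (intro bounded_linear.continuous_on[OF matrix_vector_mul_bounded_linear] continuous_on_add
      continuous_on_basis_D2 continuous_on_basis_D3 continuous_on_velocity continuous_on_acceleration)

section \<open>One-sided derivatives\<close>

text \<open>
  By the fundamental theorem of calculus \<open>f\<close> is a constant plus the integral of \<open>g\<close>, and the
  integral of a continuous function is differentiable at the endpoints too.
\<close>

lemma has_vector_derivative_closed_interval:
  fixes f :: "real \<Rightarrow> 'a::banach"
  assumes f: "continuous_on {a..b} f" and g: "continuous_on {a..b} g"
    and deriv: "\<And>t. t \<in> {a<..<b} \<Longrightarrow> (f has_vector_derivative g t) (at t)"
    and t: "t \<in> {a..b}"
  shows "(f has_vector_derivative g t) (at t within {a..b})"
proof (rule has_vector_derivative_transform[OF t])
  show "((\<lambda>u. f a + integral {a..u} g) has_vector_derivative g t) (at t within {a..b})"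
    using integral_has_vector_derivative[OF g t] by (auto intro: derivative_eq_intros)
  show "f u = f a + integral {a..u} g" if u: "u \<in> {a..b}" for u
  proof -
    have "(g has_integral (f u - f a)) {a..u}"
      using u by (intro fundamental_theorem_of_calculus_interior deriv)
        (auto intro: continuous_on_subset[OF f])
    then show ?thesis by (simp add: integral_unique)
  qed
qed

lemma left_difference_quotient:
  fixes f :: "real \<Rightarrow> 'a::real_normed_vector"
  assumes "s < t" and "(f has_vector_derivative v) (at t within {s..t})"
  shows "((\<lambda>h. (f t - f (t - h)) /\<^sub>R h) \<longlongrightarrow> v) (at_right 0)"
proof -
  \<comment> \<open>The error term of the derivative, which at \<open>y = t - h\<close> is \<open>v\<close> minus the quotient.\<close>
  define e where "e y = (1 / norm (y - t)) *\<^sub>R (f y - (f t + (y - t) *\<^sub>R v))" for y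
  have small: "\<forall>\<^sub>F h in at_right 0. 0 < h \<and> h < t - s"
    using \<open>s < t\<close> eventually_at_right_real[of 0 "t - s"] by (simp add: greaterThanLessThan_iff)
  have "(e \<longlongrightarrow> 0) (at t within {s..t})"
    using assms(2) unfolding has_vector_derivative_def has_derivative_within e_def by blast
  moreover have "filterlim (\<lambda>h. t - h) (at t within {s..t}) (at_right 0)"
    unfolding filterlim_at
  proof
    show "((\<lambda>h. t - h) \<longlongrightarrow> t) (at_right 0)"
      by (auto intro!: tendsto_eq_intros)
    show "\<forall>\<^sub>F h in at_right 0. t - h \<in> {s..t} \<and> t - h \<noteq> t"
      using small by eventually_elim auto
  qed
  ultimately have "((\<lambda>h. e (t - h)) \<longlongrightarrow> 0) (at_right 0)"
    by (rule filterlim_compose)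
  then have "((\<lambda>h. v - e (t - h)) \<longlongrightarrow> v) (at_right 0)"
    by (auto intro!: tendsto_eq_intros)
  moreover have "\<forall>\<^sub>F h in at_right 0. v - e (t - h) = (f t - f (t - h)) /\<^sub>R h"
    using small by eventually_elim (simp add: e_def algebra_simps divide_inverse)
  ultimately show ?thesis
    by (rule Lim_transform_eventually)
qed

lemma left_deriv1_eqI:
  assumes "s < t" and "(f has_vector_derivative v) (at t within {s..t})"
  shows "left_deriv1 f t = v"
  unfolding left_deriv1_def
  by (intro tendsto_Lim left_difference_quotient[OF assms]) simp

lemma left_deriv2_eqI:
  assumes "s < t"
    and deriv: "\<And>u. u \<in> {s..t} \<Longrightarrow> (f has_vector_derivative g u) (at u within {s..t})"
    and second: "(g has_vector_derivative w) (at t within {s..t})"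
  shows "left_deriv2 f t = w"
  unfolding left_deriv2_def
proof (intro tendsto_Lim)
  have "\<forall>\<^sub>F h in at_right 0. 0 < h \<and> h < t - s"
    using \<open>s < t\<close> eventually_at_right_real[of 0 "t - s"] by (simp add: greaterThanLessThan_iff)
  then have "\<forall>\<^sub>F h in at_right 0. (g t - g (t - h)) /\<^sub>R h
      = (left_deriv1 f t - vector_derivative f (at (t - h))) /\<^sub>R h"
  proof eventually_elim
    case (elim h)
    then have "(f has_vector_derivative g (t - h)) (at (t - h))"
      using deriv[of "t - h"] at_within_Icc_at[of s "t - h" t] by simp
    then show ?case
      using left_deriv1_eqI[OF \<open>s < t\<close> deriv[of t]] \<open>s < t\<close> by (simp add: vector_derivative_at)
  qed
  then show "((\<lambda>h. (left_deriv1 f t - vector_derivative f (at (t - h))) /\<^sub>R h) \<longlongrightarrow> w) (at_right 0)"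
    by (rule Lim_transform_eventually[OF left_difference_quotient[OF \<open>s < t\<close> second]])
qed simp

section \<open>The continuity constraint\<close>

lemma continuity_matrix_kernel:
  assumes "continuity_matrix \<nu> z t *v b = 0"
  shows "basis_D1 \<nu> (z t) *v b = 0"
    and "basis_D2 \<nu> (z t) (left_deriv1 z t) *v b = 0"
    and "(basis_D3 \<nu> (z t) (left_deriv1 z t) (left_deriv1 z t)
           + basis_D2 \<nu> (z t) (left_deriv2 z t)) *v b = 0"
proof -
  have row: "(continuity_matrix \<nu> z t *v b) $ r = 0" for r
    using assms by simp
  show "basis_D1 \<nu> (z t) *v b = 0"
    using row[of "Inl _"] by (simp add: continuity_matrix_def Let_def matrix_vector_mult_def vec_eq_iff)
  show "basis_D2 \<nu> (z t) (left_deriv1 z t) *v b = 0"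
    using row[of "Inr (Inl _)"] by (simp add: continuity_matrix_def Let_def matrix_vector_mult_def vec_eq_iff)
  show "(basis_D3 \<nu> (z t) (left_deriv1 z t) (left_deriv1 z t)
           + basis_D2 \<nu> (z t) (left_deriv2 z t)) *v b = 0"
    using row[of "Inr (Inr _)"] by (simp add: continuity_matrix_def Let_def matrix_vector_mult_def vec_eq_iff)
qed

text \<open>
  The rows are used one block after the other: the directions in each block are derivatives of
  lower order, taken with the old coefficients \<open>b\<close>, and the blocks before it allow these to be
  replaced by the ones for the new coefficients \<open>b'\<close>.
\<close>

lemma jets_agree:
  assumes C: "continuity_matrix \<nu> z t *v (b' - b) = 0"
    and l1: "left_deriv1 z t = velocity A \<nu> b (z t)"
    and l2: "left_deriv2 z t = acceleration A \<nu> b (z t)"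
  shows "velocity A \<nu> b' (z t) = velocity A \<nu> b (z t)"
    and "acceleration A \<nu> b' (z t) = acceleration A \<nu> b (z t)"
    and "jerk A \<nu> b' (z t) = jerk A \<nu> b (z t)"
proof -
  note kernel = continuity_matrix_kernel[OF C, unfolded l1 l2 matrix_vector_mult_diff_distrib
      right_minus_eq]
  show v: "velocity A \<nu> b' (z t) = velocity A \<nu> b (z t)"
    unfolding velocity_def kernel(1) ..
  show a: "acceleration A \<nu> b' (z t) = acceleration A \<nu> b (z t)"
    unfolding acceleration_def v kernel(2) ..
  show "jerk A \<nu> b' (z t) = jerk A \<nu> b (z t)"
    unfolding jerk_def v a kernel(3) ..
qed

section \<open>Gluing along knots\<close>

text \<open>
  A closed set that does not contain \<open>t\<close> keeps a positive distance from \<open>t\<close> and so has no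
  influence on the derivative at \<open>t\<close>.  Only the pieces through \<open>t\<close> matter, and if they give the same
  derivative, then so does the union.
\<close>

lemma has_vector_derivative_finite_closed_Union:
  assumes "finite I" and "\<And>i. i \<in> I \<Longrightarrow> closed (U i)"
    and "\<And>i. i \<in> I \<Longrightarrow> t \<in> U i \<Longrightarrow> (f has_vector_derivative v) (at t within U i)"
  shows "(f has_vector_derivative v) (at t within (\<Union>i\<in>I. U i))"
  using assms
proof (induction I)
  case empty
  then show ?case
    by (simp add: has_vector_derivative_def has_derivative_def bounded_linear_scaleR_left)
next
  case (insert i I)
  have "(f has_vector_derivative v) (at t within U i)"
  proof (cases "t \<in> U i")
    case False
    then have "at t within U i = bot"
      using insert.prems(1)[of i] by (simp add: at_within_eq_bot_iff)
    then show ?thesis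
      by (simp add: has_vector_derivative_def has_derivative_def bounded_linear_scaleR_left)
  qed (use insert.prems in auto)
  moreover have "(f has_vector_derivative v) (at t within (\<Union>i\<in>I. U i))"
    using insert.prems by (intro insert.IH) auto
  ultimately show ?case
    unfolding has_vector_derivative_def has_derivative_within
    unfolding UN_insert at_within_union by (auto intro: filterlim_sup)
qed

lemma Union_consecutive_intervals:
  fixes knot :: "nat \<Rightarrow> real"
  assumes "K \<ge> 1" and "\<And>k. k < K \<Longrightarrow> knot k \<le> knot (Suc k)"
  shows "(\<Union>k<K. {knot k..knot (Suc k)}) = {knot 0..knot K}"
  using assms
proof (induction K rule: nat_induct_at_least)
  case base
  then show ?case by (simp add: lessThan_Suc)
next
  case (Suc K)
  have "knot 0 \<le> knot m" if "m \<le> K" for m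
    using that by (induction m) (auto intro: order_trans[OF _ Suc.prems])
  moreover have "(\<Union>k<Suc K. {knot k..knot (Suc k)}) = {knot 0..knot K} \<union> {knot K..knot (Suc K)}"
    using Suc.IH Suc.prems by (simp add: lessThan_Suc Un_commute)
  ultimately show ?case
    using Suc.prems[of K] by (simp add: ivl_disj_un_two_touch)
qed

text \<open>
  Here \<open>G k j\<close> is the \<open>j\<close>-th derivative on the \<open>k\<close>-th piece.  Since the knots increase strictly, two
  different pieces can meet only if they are consecutive, and then only in their common knot;
  so matching at the knots makes the derivatives well defined on the whole interval.
\<close>

lemma C_k_on_glue:
  fixes f :: "real \<Rightarrow> 'a::real_normed_vector" and knot :: "nat \<Rightarrow> real"
  assumes "K \<ge> 1" and step: "\<And>k. k < K \<Longrightarrow> knot k < knot (Suc k)"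
    and start: "\<And>k t. k < K \<Longrightarrow> t \<in> {knot k..knot (Suc k)} \<Longrightarrow> G k 0 t = f t"
    and deriv: "\<And>k j t. k < K \<Longrightarrow> j < n \<Longrightarrow> t \<in> {knot k..knot (Suc k)} \<Longrightarrow>
          (G k j has_vector_derivative G k (Suc j) t) (at t within {knot k..knot (Suc k)})"
    and cont: "\<And>k j. k < K \<Longrightarrow> j \<le> n \<Longrightarrow> continuous_on {knot k..knot (Suc k)} (G k j)"
    and match: "\<And>k j. Suc k < K \<Longrightarrow> j \<le> n \<Longrightarrow> G (Suc k) j (knot (Suc k)) = G k j (knot (Suc k))"
  shows "C_k_on n f {knot 0..knot K}"
proof -
  define I where "I k = {knot k..knot (Suc k)}" for k
  have mono: "knot i < knot j" if "i < j" "j \<le> K" for i j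
    using that
  proof (induction j)
    case (Suc j)
    then have "knot i \<le> knot j" by (cases "i = j") auto
    also have "\<dots> < knot (Suc j)" using Suc.prems by (intro step) simp
    finally show ?case .
  qed simp
  have overlap: "G k j t = G k' j t"
    if "k < k'" "k' < K" "j \<le> n" "t \<in> I k" "t \<in> I k'" for k k' j t
  proof -
    have "k' = Suc k"
    proof (rule ccontr)
      assume "k' \<noteq> Suc k"
      then have "knot (Suc k) < knot k'" using that by (intro mono) auto
      then show False using that by (auto simp: I_def)
    qed
    with that match[of k j] show ?thesis by (auto simp: I_def)
  qed
  \<comment> \<open>At a knot two pieces are available; by \<open>overlap\<close> the choice of the first is immaterial.\<close>
  define F where "F j t = G (LEAST k. k < K \<and> t \<in> I k) j t" for j t
  have F: "F j t = G k j t" if "k < K" "j \<le> n" "t \<in> I k" for k j t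
  proof -
    let ?m = "LEAST k. k < K \<and> t \<in> I k"
    have "?m < K \<and> t \<in> I ?m" by (rule LeastI[of _ k]) (use that in auto)
    moreover have "?m \<le> k" by (rule Least_le) (use that in auto)
    ultimately show ?thesis
      using overlap[of ?m k j t] that unfolding F_def by (cases "?m = k") auto
  qed
  have UI: "{knot 0..knot K} = (\<Union>k<K. I k)"
    unfolding I_def using \<open>K \<ge> 1\<close> step by (intro Union_consecutive_intervals[symmetric]) (auto intro: less_imp_le)
  show ?thesis
    unfolding C_k_on_def UI
  proof (intro exI[of _ F] conjI ballI allI impI)
    fix t assume "t \<in> (\<Union>k<K. I k)"
    then show "F 0 t = f t" using F[of _ 0 t] start by (auto simp: I_def)
  next
    fix j t assume j: "j < n" and "t \<in> (\<Union>k<K. I k)"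
    show "(F j has_vector_derivative F (Suc j) t) (at t within (\<Union>k<K. I k))"
    proof (rule has_vector_derivative_finite_closed_Union)
      fix k assume "k \<in> {..<K}" and t: "t \<in> I k"
      then have k: "k < K" by simp
      have "(G k j has_vector_derivative F (Suc j) t) (at t within I k)"
        using deriv[OF k j] t F[OF k _ t, of "Suc j"] j by (simp add: I_def)
      then show "(F j has_vector_derivative F (Suc j) t) (at t within I k)"
        by (rule has_vector_derivative_transform[OF t, rotated]) (use F[OF k] j in auto)
    qed (auto simp: I_def)
  next
    fix j assume j: "j \<le> n"
    show "continuous_on (\<Union>k<K. I k) (F j)"
    proof (rule continuous_on_closed_Union)
      fix k assume "k \<in> {..<K}"
      then have "continuous_on (I k) (F j) \<longleftrightarrow> continuous_on (I k) (G k j)"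
        using F j by (intro continuous_on_cong) auto
      then show "continuous_on (I k) (F j)"
        using cont[of k j] \<open>k \<in> {..<K}\<close> j by (simp add: I_def)
    qed (auto simp: I_def)
  qed
qed

section \<open>Regularity of the trajectory\<close>

theorem theorem4p1:
  fixes l p K :: nat
    and \<nu> :: "'m::finite \<Rightarrow> nat ^ ('d::finite + 'd)"
    and knot :: "nat \<Rightarrow> real" and T :: real
    and a :: "real \<Rightarrow> real ^ 'm" and ak :: "nat \<Rightarrow> real ^ 'm"
    and z :: "real \<Rightarrow> real ^ ('d + 'd)" and z0 :: "real ^ ('d + 'd)"
  assumes "l \<ge> 1" and "p = 2 * l"
    and "bij_betw \<nu> UNIV (R_set p)"
    and "K \<ge> 1" and "knot 0 = 0" and "knot K = T"
    and "\<And>k. k < K \<Longrightarrow> knot k < knot (Suc k)"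
    and "\<And>k t. k < K \<Longrightarrow> t \<in> {knot k..<knot (Suc k)} \<Longrightarrow> a t = ak k"
    and "continuous_on {0..T} z"
    and "\<And>k t. k < K \<Longrightarrow> t \<in> {knot k<..<knot (Suc k)} \<Longrightarrow>
           (z has_vector_derivative J *v grad (\<lambda>y. hamiltonian \<nu> y (a t)) (z t)) (at t)"
    and "z 0 = z0"
    and "\<And>k. 1 \<le> k \<Longrightarrow> k \<le> K - 1 \<Longrightarrow>
           continuity_matrix \<nu> z (knot k) *v (ak k - ak (k - 1)) = 0"
  shows "C_k_on 3 z {0..T}"
proof -
  note step = assms(7)
  define jet where "jet b j = [\<lambda>y. y, velocity J \<nu> b, acceleration J \<nu> b, jerk J \<nu> b] ! j" for b j
  have jet: "jet b 0 = (\<lambda>y. y)" "jet b (Suc 0) = velocity J \<nu> b"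
    "jet b (Suc (Suc 0)) = acceleration J \<nu> b" "jet b (Suc (Suc (Suc 0))) = jerk J \<nu> b" for b
    by (simp_all add: jet_def)
  have zk: "continuous_on {knot k..knot (Suc k)} z" if "k < K" for k
  proof (rule continuous_on_subset[OF \<open>continuous_on {0..T} z\<close>])
    have "(\<Union>k<K. {knot k..knot (Suc k)}) = {0..T}"
      using Union_consecutive_intervals[of K knot] step assms(4-6) by (auto intro: less_imp_le)
    then show "{knot k..knot (Suc k)} \<subseteq> {0..T}" using that by blast
  qed
  have deriv: "(z has_vector_derivative velocity J \<nu> (ak k) (z t)) (at t within {knot k..knot (Suc k)})"
    if k: "k < K" and t: "t \<in> {knot k..knot (Suc k)}" for k t
  proof (rule has_vector_derivative_closed_interval[OF zk[OF k] _ _ t])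
    show "continuous_on {knot k..knot (Suc k)} (\<lambda>t. velocity J \<nu> (ak k) (z t))"
      by (rule continuous_on_velocity[OF zk[OF k]])
    show "(z has_vector_derivative velocity J \<nu> (ak k) (z u)) (at u)"
      if "u \<in> {knot k<..<knot (Suc k)}" for u
      using assms(10)[OF k that] assms(8)[OF k, of u] that
      by (simp add: velocity_def grad_hamiltonian)
  qed
  have "C_k_on 3 z {knot 0..knot K}"
  proof (rule C_k_on_glue[where knot = knot and G = "\<lambda>k j t. jet (ak k) j (z t)", OF \<open>K \<ge> 1\<close> step])
    fix k t assume "k < K" "t \<in> {knot k..knot (Suc k)}"
    show "jet (ak k) 0 (z t) = z t" by (simp add: jet)
  next
    fix k j :: nat and t
    assume k: "k < K" and j: "j < 3" and t: "t \<in> {knot k..knot (Suc k)}"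
    show "((\<lambda>t. jet (ak k) j (z t)) has_vector_derivative jet (ak k) (Suc j) (z t))
        (at t within {knot k..knot (Suc k)})"
      using j deriv[OF k t] velocity_along_solution[OF deriv[OF k t]]
        acceleration_along_solution[OF deriv[OF k t]]
      by (auto simp: numeral_3_eq_3 less_Suc_eq jet)
  next
    fix k j :: nat assume k: "k < K" and j: "j \<le> 3"
    show "continuous_on {knot k..knot (Suc k)} (\<lambda>t. jet (ak k) j (z t))"
      using j zk[OF k]
      by (auto simp: numeral_3_eq_3 le_Suc_eq jet
          intro: continuous_on_velocity continuous_on_acceleration continuous_on_jerk)
  next
    fix k j :: nat assume k: "Suc k < K" and j: "j \<le> 3"
    let ?t = "knot (Suc k)"
    have lt: "knot k < ?t" and k': "k < K" using step k by auto
    have l1: "left_deriv1 z ?t = velocity J \<nu> (ak k) (z ?t)"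
      using lt by (intro left_deriv1_eqI[OF lt] deriv k') auto
    have l2: "left_deriv2 z ?t = acceleration J \<nu> (ak k) (z ?t)"
      using lt by (intro left_deriv2_eqI[OF lt deriv[OF k']] velocity_along_solution deriv[OF k']) auto
    have "continuity_matrix \<nu> z ?t *v (ak (Suc k) - ak k) = 0"
      using assms(12)[of "Suc k"] k by simp
    from jets_agree[OF this l1 l2] j
    show "jet (ak (Suc k)) j (z ?t) = jet (ak k) j (z ?t)"
      by (auto simp: numeral_3_eq_3 le_Suc_eq jet)
  qed
  then show ?thesis using assms(5,6) by simp
qed

end
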